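(* The 2-monad $\mathrm T_q$ on $\mathbf{RD}$ is lax idempotent: for every relational doctrine $R$ there is a 2-arrow $$\lambda^R:\mathrm T_q(E^R)\Rightarrow E^{\mathrm T_q(R)}$$ in $\mathbf{RD}$, natural in $R$, such that $\lambda^RE^R=\mathrm{id}_{\mathrm T_q(E^R)\circ E^R}$ and $M^R\lambda^R=\mathrm{id}_{\mathrm{id}_{\mathrm T_q(R)}}$.
   Context: $\mathbf{Pos}$ is the category of posets and monotone maps. A relational doctrine consists of a category $\mathcal C$ (its base); a functor $R:(\mathcal C\times\mathcal C)^{op}\to\mathbf{Pos}$ (for $f:X\to A$, $g:Y\to B$ write $R_{f,g}:R(A,B)\to R(X,Y)$); elements $d_X\in R(X,X)$ with $d_X\le R_{f,f}(d_Y)$ for all $f:X\to Y$; monotone maps $;:R(X,Y)\times R(Y,Z)\to R(X,Z)$ with $R_{f,g}(\alpha);R_{g,h}(\beta)\le R_{f,h}(\alpha;\beta)$; monotone maps $(-)^\bot:R(X,Y)\to R(Y,X)$ with $(R_{f,g}(\alpha))^\bot\le R_{g,f}(\alpha^\bot)$; such that $;$ is associative with units $d$, $(\alpha;\beta)^\bot=\beta^\bot;\alpha^\bot$, $d_X^\bot=d_X$, $\alpha^{\bot\bot}=\alpha$. An $R$-equivalence relation on $X$ is $\rho\in R(X,X)$ with $d_X\le\rho$, $\rho^\bot\le\rho$, $\rho;\rho\le\rho$. The 2-category $\mathbf{RD}$: objects are relational doctrines; a 1-arrow $F:R\to S$ (bases $\mathcal C,\mathcal D$) is a pair of a functor $\widehat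 F:\mathcal C\to\mathcal D$ and a natural transformation with components $\overline F_{X,Y}:R(X,Y)\to S(\widehat FX,\widehat FY)$ strictly preserving $d$, $;$ and $(-)^\bot$; a 2-arrow $\theta:F\Rightarrow G$ is a natural transformation $\theta:\widehat F\to\widehat G$ with $\overline F_{X,Y}(\alpha)\le S_{\theta_X,\theta_Y}(\overline G_{X,Y}(\alpha))$. Intensional quotient completion $R^q$ of $R$ (base $\mathcal C$): the base has objects the pairs $(X,\rho)$ with $\rho$ an $R$-equivalence relation on $X$; arrows $(X,\rho)\to(Y,\sigma)$ are the arrows $f:X\to Y$ of $\mathcal C$ with $\rho\le R_{f,f}(\sigma)$; composition and identities as in $\mathcal C$. The fibres are $R^q((X,\rho),(Y,\sigma))=\{\alpha\in R(X,Y)\mid\rho^\bot;\alpha;\sigma\le\alpha\}$, reindexing, composition and converse are those of $R$, and $d_{(X,\rho)}=\rho$. The strict 2-monad $\mathrm T_q$ on $\mathbf{RD}$: $\mathrm T_q(R)=R^q$; for a 1-arrow $F$, $\mathrm T_q(F)=F^q$ with $\widehat{F^q}(X,\rho)=(\widehat FX,\overline F_{X,X}(\rho))$, $\widehat{F^q}f=\widehat Ff$, $\overline{F^q}(\alpha)=\overline F_{X,Y}(\alpha)$; for a 2-arrow $\theta$, $\mathrm T_q(\theta)_{(X,\rho)}=\theta_X$. Its unit is $E^R:R\to R^q$, with $\widehat{E^R}X=(X,d_X)$, $\widehat{E^R}f=f$, $\overline{E^R}$ the identity. Its multiplication is $M^R:(R^q)^q\to R^q$, with $\widehat{M^R}((X,\rho),\sigma)=(X,\sigma)$,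 $\widehat{M^R}f=f$, $\overline{M^R}$ componentwise the identity. Juxtaposition such as $\lambda^RE^R$ and $M^R\lambda^R$ denotes whiskering. *)

theory Defs
  imports Main "HOL-Library.FuncSet"
begin

section \<open>Categories and relational doctrines\<close>

text \<open>
  Hom-sets and fibres are sets indexed by objects which need not be disjoint, so that one
  and the same element may be an arrow between different pairs of objects, as happens in the
  intensional quotient completion. All operations therefore carry their objects as arguments;
  only their values on the relevant carriers matter.
  \<open>Comp C X Y Z g f\<close> is the composite of \<open>f : X \<rightarrow> Y\<close> followed by \<open>g : Y \<rightarrow> Z\<close>.
\<close>

record ('o, 'a) category =
  Ob :: "'o set"
  Hom :: "'o \<Rightarrow> 'o \<Rightarrow> 'a set"
  Ident :: "'o \<Rightarrow> 'a"
  Comp :: "'o \<Rightarrow> 'o \<Rightarrow> 'o \<Rightarrow> 'a \<Rightarrow> 'a \<Rightarrow> 'a"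

locale category =
  fixes C :: "('o, 'a, 'x) category_scheme"
  assumes Ident_Hom: "X \<in> Ob C \<Longrightarrow> Ident C X \<in> Hom C X X"
    and Comp_Hom: "\<lbrakk>X \<in> Ob C; Y \<in> Ob C; Z \<in> Ob C; f \<in> Hom C X Y; g \<in> Hom C Y Z\<rbrakk>
      \<Longrightarrow> Comp C X Y Z g f \<in> Hom C X Z"
    and Comp_Ident_right: "\<lbrakk>X \<in> Ob C; Y \<in> Ob C; f \<in> Hom C X Y\<rbrakk>
      \<Longrightarrow> Comp C X X Y f (Ident C X) = f"
    and Comp_Ident_left: "\<lbrakk>X \<in> Ob C; Y \<in> Ob C; f \<in> Hom C X Y\<rbrakk>
      \<Longrightarrow> Comp C X Y Y (Ident C Y) f = f"
    and Comp_assoc: "\<lbrakk>W \<in> Ob C; X \<in> Ob C; Y \<in> Ob C; Z \<in> Ob C;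
        f \<in> Hom C W X; g \<in> Hom C X Y; h \<in> Hom C Y Z\<rbrakk>
      \<Longrightarrow> Comp C W Y Z h (Comp C W X Y g f) = Comp C W X Z (Comp C X Y Z h g) f"

text \<open>
  A relational doctrine extends its base category. For \<open>f : X \<rightarrow> A\<close> and \<open>g : Y \<rightarrow> B\<close>,
  \<open>Reidx R X Y A B f g\<close> is the reindexing map from the fibre over \<open>(A, B)\<close> to the fibre
  over \<open>(X, Y)\<close>. \<open>Diag R X\<close> is $d_X$, \<open>Seq R X Y Z \<alpha> \<beta>\<close> is $\alpha;\beta$ and
  \<open>Conv R X Y \<alpha>\<close> is $\alpha^\bot$.
\<close>

record ('o, 'a, 'r) rel_doctrine = "('o, 'a) category" +
  Rel :: "'o \<Rightarrow> 'o \<Rightarrow> 'r set"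
  Le :: "'o \<Rightarrow> 'o \<Rightarrow> 'r \<Rightarrow> 'r \<Rightarrow> bool"
  Reidx :: "'o \<Rightarrow> 'o \<Rightarrow> 'o \<Rightarrow> 'o \<Rightarrow> 'a \<Rightarrow> 'a \<Rightarrow> 'r \<Rightarrow> 'r"
  Diag :: "'o \<Rightarrow> 'r"
  Seq :: "'o \<Rightarrow> 'o \<Rightarrow> 'o \<Rightarrow> 'r \<Rightarrow> 'r \<Rightarrow> 'r"
  Conv :: "'o \<Rightarrow> 'o \<Rightarrow> 'r \<Rightarrow> 'r"

locale relational_doctrine = category R
  for R :: "('o, 'a, 'r) rel_doctrine" +
  assumes Le_refl: "\<lbrakk>X \<in> Ob R; Y \<in> Ob R\<rbrakk> \<Longrightarrow> reflp_on (Rel R X Y) (Le R X Y)"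
    and Le_trans: "\<lbrakk>X \<in> Ob R; Y \<in> Ob R\<rbrakk> \<Longrightarrow> transp_on (Rel R X Y) (Le R X Y)"
    and Le_antisym: "\<lbrakk>X \<in> Ob R; Y \<in> Ob R\<rbrakk> \<Longrightarrow> antisymp_on (Rel R X Y) (Le R X Y)"
    and Reidx_Rel: "\<lbrakk>X \<in> Ob R; Y \<in> Ob R; A \<in> Ob R; B \<in> Ob R; f \<in> Hom R X A; g \<in> Hom R Y B;
        \<alpha> \<in> Rel R A B\<rbrakk> \<Longrightarrow> Reidx R X Y A B f g \<alpha> \<in> Rel R X Y"
    and Reidx_mono: "\<lbrakk>X \<in> Ob R; Y \<in> Ob R; A \<in> Ob R; B \<in> Ob R; f \<in> Hom R X A; g \<in> Hom R Y B\<rbrakk>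
      \<Longrightarrow> monotone_on (Rel R A B) (Le R A B) (Le R X Y) (Reidx R X Y A B f g)"
    and Reidx_Ident: "\<lbrakk>X \<in> Ob R; Y \<in> Ob R; \<alpha> \<in> Rel R X Y\<rbrakk>
      \<Longrightarrow> Reidx R X Y X Y (Ident R X) (Ident R Y) \<alpha> = \<alpha>"
    and Reidx_Comp: "\<lbrakk>X \<in> Ob R; Y \<in> Ob R; A \<in> Ob R; B \<in> Ob R; A' \<in> Ob R; B' \<in> Ob R;
        f \<in> Hom R X A; g \<in> Hom R Y B; f' \<in> Hom R A A'; g' \<in> Hom R B B'; \<alpha> \<in> Rel R A' B'\<rbrakk>
      \<Longrightarrow> Reidx R X Y A' B' (Comp R X A A' f' f) (Comp R Y B B' g' g) \<alpha>
        = Reidx R X Y A B f g (Reidx R A B A' B' f' g' \<alpha>)"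
    and Diag_Rel: "X \<in> Ob R \<Longrightarrow> Diag R X \<in> Rel R X X"
    and Diag_Reidx: "\<lbrakk>X \<in> Ob R; Y \<in> Ob R; f \<in> Hom R X Y\<rbrakk>
      \<Longrightarrow> Le R X X (Diag R X) (Reidx R X X Y Y f f (Diag R Y))"
    and Seq_Rel: "\<lbrakk>X \<in> Ob R; Y \<in> Ob R; Z \<in> Ob R; \<alpha> \<in> Rel R X Y; \<beta> \<in> Rel R Y Z\<rbrakk>
      \<Longrightarrow> Seq R X Y Z \<alpha> \<beta> \<in> Rel R X Z"
    and Seq_mono: "\<lbrakk>X \<in> Ob R; Y \<in> Ob R; Z \<in> Ob R;
        \<alpha> \<in> Rel R X Y; \<alpha>' \<in> Rel R X Y; \<beta> \<in> Rel R Y Z; \<beta>' \<in> Rel R Y Z;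
        Le R X Y \<alpha> \<alpha>'; Le R Y Z \<beta> \<beta>'\<rbrakk>
      \<Longrightarrow> Le R X Z (Seq R X Y Z \<alpha> \<beta>) (Seq R X Y Z \<alpha>' \<beta>')"
    and Seq_Reidx: "\<lbrakk>X \<in> Ob R; Y \<in> Ob R; Z \<in> Ob R; A \<in> Ob R; B \<in> Ob R; D \<in> Ob R;
        f \<in> Hom R X A; g \<in> Hom R Y B; h \<in> Hom R Z D; \<alpha> \<in> Rel R A B; \<beta> \<in> Rel R B D\<rbrakk>
      \<Longrightarrow> Le R X Z (Seq R X Y Z (Reidx R X Y A B f g \<alpha>) (Reidx R Y Z B D g h \<beta>))
                   (Reidx R X Z A D f h (Seq R A B D \<alpha> \<beta>))"
    and Seq_assoc: "\<lbrakk>W \<in> Ob R; X \<in> Ob R; Y \<in> Ob R; Z \<in> Ob R;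
        \<alpha> \<in> Rel R W X; \<beta> \<in> Rel R X Y; \<gamma> \<in> Rel R Y Z\<rbrakk>
      \<Longrightarrow> Seq R W Y Z (Seq R W X Y \<alpha> \<beta>) \<gamma> = Seq R W X Z \<alpha> (Seq R X Y Z \<beta> \<gamma>)"
    and Seq_Diag_left: "\<lbrakk>X \<in> Ob R; Y \<in> Ob R; \<alpha> \<in> Rel R X Y\<rbrakk>
      \<Longrightarrow> Seq R X X Y (Diag R X) \<alpha> = \<alpha>"
    and Seq_Diag_right: "\<lbrakk>X \<in> Ob R; Y \<in> Ob R; \<alpha> \<in> Rel R X Y\<rbrakk>
      \<Longrightarrow> Seq R X Y Y \<alpha> (Diag R Y) = \<alpha>"
    and Conv_Rel: "\<lbrakk>X \<in> Ob R; Y \<in> Ob R; \<alpha> \<in> Rel R X Y\<rbrakk> \<Longrightarrow> Conv R X Y \<alpha> \<in> Rel R Y X"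
    and Conv_mono: "\<lbrakk>X \<in> Ob R; Y \<in> Ob R\<rbrakk>
      \<Longrightarrow> monotone_on (Rel R X Y) (Le R X Y) (Le R Y X) (Conv R X Y)"
    and Conv_Reidx: "\<lbrakk>X \<in> Ob R; Y \<in> Ob R; A \<in> Ob R; B \<in> Ob R; f \<in> Hom R X A; g \<in> Hom R Y B;
        \<alpha> \<in> Rel R A B\<rbrakk>
      \<Longrightarrow> Le R Y X (Conv R X Y (Reidx R X Y A B f g \<alpha>)) (Reidx R Y X B A g f (Conv R A B \<alpha>))"
    and Conv_Seq: "\<lbrakk>X \<in> Ob R; Y \<in> Ob R; Z \<in> Ob R; \<alpha> \<in> Rel R X Y; \<beta> \<in> Rel R Y Z\<rbrakk>
      \<Longrightarrow> Conv R X Z (Seq R X Y Z \<alpha> \<beta>) = Seq R Z Y X (Conv R Y Z \<beta>) (Conv R X Y \<alpha>)"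
    and Conv_Diag: "X \<in> Ob R \<Longrightarrow> Conv R X X (Diag R X) = Diag R X"
    and Conv_Conv: "\<lbrakk>X \<in> Ob R; Y \<in> Ob R; \<alpha> \<in> Rel R X Y\<rbrakk>
      \<Longrightarrow> Conv R Y X (Conv R X Y \<alpha>) = \<alpha>"

definition equiv_rel :: "('o, 'a, 'r) rel_doctrine \<Rightarrow> 'o \<Rightarrow> 'r \<Rightarrow> bool" where
  "equiv_rel R X \<rho> \<longleftrightarrow> \<rho> \<in> Rel R X X \<and> Le R X X (Diag R X) \<rho> \<and>
     Le R X X (Conv R X X \<rho>) \<rho> \<and> Le R X X (Seq R X X X \<rho> \<rho>) \<rho>"


section \<open>The 2-category of relational doctrines\<close>

text \<open>
  1-arrows and 2-arrows carry their boundaries, and their maps are \<^const>\<open>undefined\<close> outside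
  the relevant carriers. Hence HOL equality is equality of 1-arrows and of 2-arrows in the
  2-category; in particular, an equation between 2-arrows asserts that their sources and
  their targets coincide.
\<close>

record ('o, 'a, 'r, 'p, 'b, 's) arrow1 =
  Dom1 :: "('o, 'a, 'r) rel_doctrine"
  Cod1 :: "('p, 'b, 's) rel_doctrine"
  obj_map :: "'o \<Rightarrow> 'p"
  arr_map :: "'o \<Rightarrow> 'o \<Rightarrow> 'a \<Rightarrow> 'b"
  rel_map :: "'o \<Rightarrow> 'o \<Rightarrow> 'r \<Rightarrow> 's"

locale is_arrow1 =
  fixes F :: "('o, 'a, 'r, 'p, 'b, 's) arrow1"
    and R :: "('o, 'a, 'r) rel_doctrine"
    and S :: "('p, 'b, 's) rel_doctrine"
  assumes Dom1_eq: "Dom1 F = R"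
    and Cod1_eq: "Cod1 F = S"
    and Dom1_doctrine: "relational_doctrine R"
    and Cod1_doctrine: "relational_doctrine S"
    and obj_map_type: "obj_map F \<in> Ob R \<rightarrow>\<^sub>E Ob S"
    and arr_map_type: "arr_map F \<in> (\<Pi>\<^sub>E X\<in>Ob R. \<Pi>\<^sub>E Y\<in>Ob R.
        Hom R X Y \<rightarrow>\<^sub>E Hom S (obj_map F X) (obj_map F Y))"
    and arr_map_Ident: "X \<in> Ob R \<Longrightarrow> arr_map F X X (Ident R X) = Ident S (obj_map F X)"
    and arr_map_Comp: "\<lbrakk>X \<in> Ob R; Y \<in> Ob R; Z \<in> Ob R; f \<in> Hom R X Y; g \<in> Hom R Y Z\<rbrakk>
      \<Longrightarrow> arr_map F X Z (Comp R X Y Z g f)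
        = Comp S (obj_map F X) (obj_map F Y) (obj_map F Z) (arr_map F Y Z g) (arr_map F X Y f)"
    and rel_map_type: "rel_map F \<in> (\<Pi>\<^sub>E X\<in>Ob R. \<Pi>\<^sub>E Y\<in>Ob R.
        Rel R X Y \<rightarrow>\<^sub>E Rel S (obj_map F X) (obj_map F Y))"
    and rel_map_mono: "\<lbrakk>X \<in> Ob R; Y \<in> Ob R\<rbrakk>
      \<Longrightarrow> monotone_on (Rel R X Y) (Le R X Y) (Le S (obj_map F X) (obj_map F Y)) (rel_map F X Y)"
    and rel_map_Reidx: "\<lbrakk>X \<in> Ob R; Y \<in> Ob R; A \<in> Ob R; B \<in> Ob R; f \<in> Hom R X A; g \<in> Hom R Y B;
        \<alpha> \<in> Rel R A B\<rbrakk>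
      \<Longrightarrow> rel_map F X Y (Reidx R X Y A B f g \<alpha>)
        = Reidx S (obj_map F X) (obj_map F Y) (obj_map F A) (obj_map F B)
            (arr_map F X A f) (arr_map F Y B g) (rel_map F A B \<alpha>)"
    and rel_map_Diag: "X \<in> Ob R \<Longrightarrow> rel_map F X X (Diag R X) = Diag S (obj_map F X)"
    and rel_map_Seq: "\<lbrakk>X \<in> Ob R; Y \<in> Ob R; Z \<in> Ob R; \<alpha> \<in> Rel R X Y; \<beta> \<in> Rel R Y Z\<rbrakk>
      \<Longrightarrow> rel_map F X Z (Seq R X Y Z \<alpha> \<beta>)
        = Seq S (obj_map F X) (obj_map F Y) (obj_map F Z) (rel_map F X Y \<alpha>) (rel_map F Y Z \<beta>)"
    and rel_map_Conv: "\<lbrakk>X \<in> Ob R; Y \<in> Ob R; \<alpha> \<in> Rel R X Y\<rbrakk>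
      \<Longrightarrow> rel_map F Y X (Conv R X Y \<alpha>) = Conv S (obj_map F X) (obj_map F Y) (rel_map F X Y \<alpha>)"

definition id1 :: "('o, 'a, 'r) rel_doctrine \<Rightarrow> ('o, 'a, 'r, 'o, 'a, 'r) arrow1" where
  "id1 R = \<lparr>Dom1 = R, Cod1 = R,
     obj_map = (\<lambda>X\<in>Ob R. X),
     arr_map = (\<lambda>X\<in>Ob R. \<lambda>Y\<in>Ob R. \<lambda>f\<in>Hom R X Y. f),
     rel_map = (\<lambda>X\<in>Ob R. \<lambda>Y\<in>Ob R. \<lambda>\<alpha>\<in>Rel R X Y. \<alpha>)\<rparr>"

definition comp1 :: "('p, 'b, 's, 'q, 'c, 't) arrow1 \<Rightarrow> ('o, 'a, 'r, 'p, 'b, 's) arrow1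
    \<Rightarrow> ('o, 'a, 'r, 'q, 'c, 't) arrow1"  (infixr \<open>\<circ>\<^sub>1\<close> 70) where
  "G \<circ>\<^sub>1 F = \<lparr>Dom1 = Dom1 F, Cod1 = Cod1 G,
     obj_map = (\<lambda>X\<in>Ob (Dom1 F). obj_map G (obj_map F X)),
     arr_map = (\<lambda>X\<in>Ob (Dom1 F). \<lambda>Y\<in>Ob (Dom1 F). \<lambda>f\<in>Hom (Dom1 F) X Y.
        arr_map G (obj_map F X) (obj_map F Y) (arr_map F X Y f)),
     rel_map = (\<lambda>X\<in>Ob (Dom1 F). \<lambda>Y\<in>Ob (Dom1 F). \<lambda>\<alpha>\<in>Rel (Dom1 F) X Y.
        rel_map G (obj_map F X) (obj_map F Y) (rel_map F X Y \<alpha>))\<rparr>"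

record ('o, 'a, 'r, 'p, 'b, 's) arrow2 =
  Src2 :: "('o, 'a, 'r, 'p, 'b, 's) arrow1"
  Trg2 :: "('o, 'a, 'r, 'p, 'b, 's) arrow1"
  component :: "'o \<Rightarrow> 'b"

locale is_arrow2 =
  fixes \<theta> :: "('o, 'a, 'r, 'p, 'b, 's) arrow2"
    and R :: "('o, 'a, 'r) rel_doctrine"
    and S :: "('p, 'b, 's) rel_doctrine"
    and F G :: "('o, 'a, 'r, 'p, 'b, 's) arrow1"
  assumes Src2_eq: "Src2 \<theta> = F"
    and Trg2_eq: "Trg2 \<theta> = G"
    and Src2_arrow1: "is_arrow1 F R S"
    and Trg2_arrow1: "is_arrow1 G R S"
    and component_type: "component \<theta> \<in> (\<Pi>\<^sub>E X\<in>Ob R. Hom S (obj_map F X) (obj_map G X))"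
    and component_natural: "\<lbrakk>X \<in> Ob R; Y \<in> Ob R; f \<in> Hom R X Y\<rbrakk>
      \<Longrightarrow> Comp S (obj_map F X) (obj_map F Y) (obj_map G Y) (component \<theta> Y) (arr_map F X Y f)
        = Comp S (obj_map F X) (obj_map G X) (obj_map G Y) (arr_map G X Y f) (component \<theta> X)"
    and component_Le: "\<lbrakk>X \<in> Ob R; Y \<in> Ob R; \<alpha> \<in> Rel R X Y\<rbrakk>
      \<Longrightarrow> Le S (obj_map F X) (obj_map F Y) (rel_map F X Y \<alpha>)
           (Reidx S (obj_map F X) (obj_map F Y) (obj_map G X) (obj_map G Y)
              (component \<theta> X) (component \<theta> Y) (rel_map G X Y \<alpha>))"

definition id2 :: "('o, 'a, 'r, 'p, 'b, 's) arrow1 \<Rightarrow> ('o, 'a, 'r, 'p, 'b, 's) arrow2" where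
  "id2 F = \<lparr>Src2 = F, Trg2 = F,
     component = (\<lambda>X\<in>Ob (Dom1 F). Ident (Cod1 F) (obj_map F X))\<rparr>"

text \<open>\<open>\<theta> \<triangleleft> K\<close> and \<open>H \<triangleright> \<theta>\<close> are the whiskerings written $\theta K$ and $H\theta$ by juxtaposition.\<close>

definition whisker_right :: "('p, 'b, 's, 'q, 'c, 't) arrow2 \<Rightarrow> ('o, 'a, 'r, 'p, 'b, 's) arrow1
    \<Rightarrow> ('o, 'a, 'r, 'q, 'c, 't) arrow2"  (infix \<open>\<triangleleft>\<close> 65) where
  "\<theta> \<triangleleft> K = \<lparr>Src2 = Src2 \<theta> \<circ>\<^sub>1 K, Trg2 = Trg2 \<theta> \<circ>\<^sub>1 K,
     component = (\<lambda>X\<in>Ob (Dom1 K). component \<theta> (obj_map K X))\<rparr>"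

definition whisker_left :: "('p, 'b, 's, 'q, 'c, 't) arrow1 \<Rightarrow> ('o, 'a, 'r, 'p, 'b, 's) arrow2
    \<Rightarrow> ('o, 'a, 'r, 'q, 'c, 't) arrow2"  (infix \<open>\<triangleright>\<close> 65) where
  "H \<triangleright> \<theta> = \<lparr>Src2 = H \<circ>\<^sub>1 Src2 \<theta>, Trg2 = H \<circ>\<^sub>1 Trg2 \<theta>,
     component = (\<lambda>X\<in>Ob (Dom1 (Src2 \<theta>)).
        arr_map H (obj_map (Src2 \<theta>) X) (obj_map (Trg2 \<theta>) X) (component \<theta> X))\<rparr>"


section \<open>The 2-monad of intensional quotients\<close>

definition Tq :: "('o, 'a, 'r) rel_doctrine \<Rightarrow> ('o \<times> 'r, 'a, 'r) rel_doctrine" where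
  "Tq R = \<lparr>
     Ob = {(X, \<rho>). X \<in> Ob R \<and> equiv_rel R X \<rho>},
     Hom = (\<lambda>(X, \<rho>) (Y, \<sigma>). {f \<in> Hom R X Y. Le R X X \<rho> (Reidx R X X Y Y f f \<sigma>)}),
     Ident = (\<lambda>(X, \<rho>). Ident R X),
     Comp = (\<lambda>(X, \<rho>) (Y, \<sigma>) (Z, \<tau>). Comp R X Y Z),
     Rel = (\<lambda>(X, \<rho>) (Y, \<sigma>).
       {\<alpha> \<in> Rel R X Y. Le R X Y (Seq R X Y Y (Seq R X X Y (Conv R X X \<rho>) \<alpha>) \<sigma>) \<alpha>}),
     Le = (\<lambda>(X, \<rho>) (Y, \<sigma>). Le R X Y),
     Reidx = (\<lambda>(X, \<rho>) (Y, \<sigma>) (A, \<mu>) (B, \<nu>). Reidx R X Y A B),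
     Diag = (\<lambda>(X, \<rho>). \<rho>),
     Seq = (\<lambda>(X, \<rho>) (Y, \<sigma>) (Z, \<tau>). Seq R X Y Z),
     Conv = (\<lambda>(X, \<rho>) (Y, \<sigma>). Conv R X Y)\<rparr>"

definition Tq1 :: "('o, 'a, 'r, 'p, 'b, 's) arrow1
    \<Rightarrow> ('o \<times> 'r, 'a, 'r, 'p \<times> 's, 'b, 's) arrow1" where
  "Tq1 F = (let Q = Tq (Dom1 F) in \<lparr>
     Dom1 = Q, Cod1 = Tq (Cod1 F),
     obj_map = (\<lambda>(X, \<rho>)\<in>Ob Q. (obj_map F X, rel_map F X X \<rho>)),
     arr_map = (\<lambda>U\<in>Ob Q. \<lambda>V\<in>Ob Q. \<lambda>f\<in>Hom Q U V. arr_map F (fst U) (fst V) f),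
     rel_map = (\<lambda>U\<in>Ob Q. \<lambda>V\<in>Ob Q. \<lambda>\<alpha>\<in>Rel Q U V. rel_map F (fst U) (fst V) \<alpha>)\<rparr>)"

definition Eq :: "('o, 'a, 'r) rel_doctrine \<Rightarrow> ('o, 'a, 'r, 'o \<times> 'r, 'a, 'r) arrow1" where
  "Eq R = \<lparr>Dom1 = R, Cod1 = Tq R,
     obj_map = (\<lambda>X\<in>Ob R. (X, Diag R X)),
     arr_map = (\<lambda>X\<in>Ob R. \<lambda>Y\<in>Ob R. \<lambda>f\<in>Hom R X Y. f),
     rel_map = (\<lambda>X\<in>Ob R. \<lambda>Y\<in>Ob R. \<lambda>\<alpha>\<in>Rel R X Y. \<alpha>)\<rparr>"

definition Mq :: "('o, 'a, 'r) rel_doctrine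
    \<Rightarrow> (('o \<times> 'r) \<times> 'r, 'a, 'r, 'o \<times> 'r, 'a, 'r) arrow1" where
  "Mq R = (let Q = Tq (Tq R) in \<lparr>Dom1 = Q, Cod1 = Tq R,
     obj_map = (\<lambda>((X, \<rho>), \<sigma>)\<in>Ob Q. (X, \<sigma>)),
     arr_map = (\<lambda>U\<in>Ob Q. \<lambda>V\<in>Ob Q. \<lambda>f\<in>Hom Q U V. f),
     rel_map = (\<lambda>U\<in>Ob Q. \<lambda>V\<in>Ob Q. \<lambda>\<alpha>\<in>Rel Q U V. \<alpha>)\<rparr>)"


section \<open>Lax idempotency\<close>

type_synonym ('o, 'a, 'r) family2 =
  "('o, 'a, 'r) rel_doctrine \<Rightarrow> ('o \<times> 'r, 'a, 'r, ('o \<times> 'r) \<times> 'r, 'a, 'r) arrow2"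

definition lax_idempotent_family :: "('o, 'a, 'r) family2 \<Rightarrow> bool" where
  "lax_idempotent_family \<Lambda> \<longleftrightarrow> (\<forall>R. relational_doctrine R \<longrightarrow>
     is_arrow2 (\<Lambda> R) (Tq R) (Tq (Tq R)) (Tq1 (Eq R)) (Eq (Tq R)) \<and>
     \<Lambda> R \<triangleleft> Eq R = id2 (Tq1 (Eq R) \<circ>\<^sub>1 Eq R) \<and>
     Mq R \<triangleright> \<Lambda> R = id2 (id1 (Tq R)))"

text \<open>
  Naturality is the modification condition with respect to 1-arrows \<open>F : R \<rightarrow> S\<close>. Since HOL cannot
  quantify over types, a family of 2-arrows bound inside a formula only covers the doctrines over
  one choice of carrier types. To allow \<open>R\<close> and \<open>S\<close> to have different carrier types, naturality
  is stated for two families, \<open>\<Lambda>\<close> at the types of \<open>R\<close> and \<open>\<Lambda>'\<close> at those of \<open>S\<close>.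
\<close>

definition natural_family :: "('o, 'a, 'r) family2 \<Rightarrow> ('p, 'b, 's) family2 \<Rightarrow> bool" where
  "natural_family \<Lambda> \<Lambda>' \<longleftrightarrow> (\<forall>R S F. is_arrow1 F R S \<longrightarrow>
     \<Lambda>' S \<triangleleft> Tq1 F = Tq1 (Tq1 F) \<triangleright> \<Lambda> R)"

end

theory Submission
  imports Defs
begin

text \<open>
  The component of $\lambda^R$ at $(X,\rho)$ is the identity of \<open>X\<close>. Indeed
  $\mathrm{T}_q(E^R)$ sends $(X,\rho)$ to $((X,d_X),\rho)$, while $E^{\mathrm{T}_q(R)}$ sends it to
  $((X,\rho),\rho)$, because $\rho$ is the diagonal of $(X,\rho)$. So $\mathrm{id}_X$ has to be an
  arrow $(X,d_X)\to(X,\rho)$ respecting $\rho$, which is just the reflexivity $d_X\le\rho$. Naturality,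
  the inequality required of a 2-arrow and the three equations then reduce to properties of identities.

  What needs work is that all the data live in the 2-category. The key is equational: an
  equivalence relation is idempotent and equal to its converse, and a relation $\alpha$ is in the fibre
  of $R^q$ over $((X,\rho),(Y,\sigma))$ iff $\rho;\alpha=\alpha=\alpha;\sigma$
  (\<open>Rel_Tq_iff_absorbs\<close>). Such equations make $\rho$ and $\sigma$ the units of $R^q$, and are
  preserved by every 1-arrow, since 1-arrows preserve $d$, $;$ and $(-)^\bot$ strictly.

  The boundaries of the whiskered 2-arrows match because $E$ is natural (\<open>Eq_natural\<close>),
  $\mathrm{T}_q$ preserves composites (\<open>Tq1_comp1\<close>) and $M$ is a retraction of both
  $\mathrm{T}_q(E)$ and $E_{\mathrm{T}_q}$ (\<open>Mq_Tq1_Eq\<close>, \<open>Mq_Eq_Tq\<close>).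
\<close>

section \<open>Equivalence relations and the relations that absorb them\<close>

context relational_doctrine
begin

lemma le_refl: "\<lbrakk>X \<in> Ob R; Y \<in> Ob R; \<alpha> \<in> Rel R X Y\<rbrakk> \<Longrightarrow> Le R X Y \<alpha> \<alpha>"
  using Le_refl by (auto dest: reflp_onD)

lemma le_trans:
  "\<lbrakk>Le R X Y \<alpha> \<beta>; Le R X Y \<beta> \<gamma>; X \<in> Ob R; Y \<in> Ob R; \<alpha> \<in> Rel R X Y; \<beta> \<in> Rel R X Y; \<gamma> \<in> Rel R X Y\<rbrakk>
    \<Longrightarrow> Le R X Y \<alpha> \<gamma>"
  using Le_trans by (blast dest: transp_onD)

lemma le_antisym:
  "\<lbrakk>Le R X Y \<alpha> \<beta>; Le R X Y \<beta> \<alpha>; X \<in> Ob R; Y \<in> Ob R; \<alpha> \<in> Rel R X Y; \<beta> \<in> Rel R X Y\<rbrakk> \<Longrightarrow> \<alpha> = \<beta>"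
  using Le_antisym by (blast dest: antisymp_onD)

lemma reidx_mono:
  "\<lbrakk>Le R A B \<alpha> \<beta>; X \<in> Ob R; Y \<in> Ob R; A \<in> Ob R; B \<in> Ob R; f \<in> Hom R X A; g \<in> Hom R Y B;
    \<alpha> \<in> Rel R A B; \<beta> \<in> Rel R A B\<rbrakk>
    \<Longrightarrow> Le R X Y (Reidx R X Y A B f g \<alpha>) (Reidx R X Y A B f g \<beta>)"
  using Reidx_mono by (blast dest: monotone_onD)

lemma conv_mono:
  "\<lbrakk>Le R X Y \<alpha> \<beta>; X \<in> Ob R; Y \<in> Ob R; \<alpha> \<in> Rel R X Y; \<beta> \<in> Rel R X Y\<rbrakk>
    \<Longrightarrow> Le R Y X (Conv R X Y \<alpha>) (Conv R X Y \<beta>)"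
  using Conv_mono by (blast dest: monotone_onD)

text \<open>
  Inflation: composing with a relation above the diagonal can only enlarge. It turns each
  absorption inequality into an equation.
\<close>

lemma le_Seq_left:
  assumes "X \<in> Ob R" "Y \<in> Ob R" "\<rho> \<in> Rel R X X" "Le R X X (Diag R X) \<rho>" "\<alpha> \<in> Rel R X Y"
  shows "Le R X Y \<alpha> (Seq R X X Y \<rho> \<alpha>)"
  using Seq_mono[of X X Y "Diag R X" \<rho> \<alpha> \<alpha>] assms by (simp add: Diag_Rel Seq_Diag_left le_refl)

lemma le_Seq_right:
  assumes "X \<in> Ob R" "Y \<in> Ob R" "\<sigma> \<in> Rel R Y Y" "Le R Y Y (Diag R Y) \<sigma>" "\<alpha> \<in> Rel R X Y"
  shows "Le R X Y \<alpha> (Seq R X Y Y \<alpha> \<sigma>)"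
  using Seq_mono[of X Y Y \<alpha> \<alpha> "Diag R Y" \<sigma>] assms by (simp add: Diag_Rel Seq_Diag_right le_refl)

lemma equiv_rel_iff:
  assumes X: "X \<in> Ob R"
  shows "equiv_rel R X \<rho> \<longleftrightarrow> \<rho> \<in> Rel R X X \<and> Le R X X (Diag R X) \<rho> \<and>
    Conv R X X \<rho> = \<rho> \<and> Seq R X X X \<rho> \<rho> = \<rho>"
proof
  assume \<rho>: "equiv_rel R X \<rho>"
  then have rel: "\<rho> \<in> Rel R X X" and refl: "Le R X X (Diag R X) \<rho>"
    and sym: "Le R X X (Conv R X X \<rho>) \<rho>" and trans: "Le R X X (Seq R X X X \<rho> \<rho>) \<rho>"
    by (auto simp: equiv_rel_def)
  \<comment> \<open>Converse is a monotone involution, so applying it to \<open>sym\<close> gives the reverse inequality.\<close>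
  have "Le R X X \<rho> (Conv R X X \<rho>)"
    using conv_mono[OF sym] X rel by (simp add: Conv_Rel Conv_Conv)
  then have "Conv R X X \<rho> = \<rho>"
    using sym le_antisym X rel Conv_Rel by blast
  moreover have "Seq R X X X \<rho> \<rho> = \<rho>"
    using trans le_Seq_left[OF X X rel refl rel] le_antisym X rel Seq_Rel by blast
  ultimately show "\<rho> \<in> Rel R X X \<and> Le R X X (Diag R X) \<rho> \<and>
    Conv R X X \<rho> = \<rho> \<and> Seq R X X X \<rho> \<rho> = \<rho>"
    using rel refl by blast
qed (auto simp: equiv_rel_def X le_refl)

lemma equiv_rel_Diag: "X \<in> Ob R \<Longrightarrow> equiv_rel R X (Diag R X)"
  by (simp add: equiv_rel_iff Diag_Rel Conv_Diag Seq_Diag_left le_refl)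

text \<open>
  Being closed under $\rho^\bot;(-);\sigma$ amounts to absorbing both relations: since they are
  reflexive, $\rho;\alpha$ and $\alpha;\sigma$ lie between $\alpha$ and $\rho;\alpha;\sigma$.
\<close>

lemma saturated_iff_absorbs:
  assumes X: "X \<in> Ob R" and Y: "Y \<in> Ob R" and "equiv_rel R X \<rho>" and "equiv_rel R Y \<sigma>"
    and \<alpha>: "\<alpha> \<in> Rel R X Y"
  shows "Le R X Y (Seq R X Y Y (Seq R X X Y (Conv R X X \<rho>) \<alpha>) \<sigma>) \<alpha> \<longleftrightarrow>
    Seq R X X Y \<rho> \<alpha> = \<alpha> \<and> Seq R X Y Y \<alpha> \<sigma> = \<alpha>"
proof
  have \<rho>: "\<rho> \<in> Rel R X X" "Le R X X (Diag R X) \<rho>" "Conv R X X \<rho> = \<rho>"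
    and \<sigma>: "\<sigma> \<in> Rel R Y Y" "Le R Y Y (Diag R Y) \<sigma>"
    using assms by (auto simp: equiv_rel_iff)
  note rels = X Y \<alpha> \<rho>(1) \<sigma>(1)
  have \<rho>\<alpha>: "Seq R X X Y \<rho> \<alpha> \<in> Rel R X Y" and \<alpha>\<sigma>: "Seq R X Y Y \<alpha> \<sigma> \<in> Rel R X Y"
    using rels by (auto intro: Seq_Rel)
  { assume "Le R X Y (Seq R X Y Y (Seq R X X Y (Conv R X X \<rho>) \<alpha>) \<sigma>) \<alpha>"
    then have sat: "Le R X Y (Seq R X Y Y (Seq R X X Y \<rho> \<alpha>) \<sigma>) \<alpha>"
      by (simp add: \<rho>)
    have "Le R X Y (Seq R X X Y \<rho> \<alpha>) \<alpha>"
      by (rule le_trans[OF le_Seq_right[OF X Y \<sigma> \<rho>\<alpha>] sat])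
        (use rels \<rho>\<alpha> in \<open>auto intro: Seq_Rel\<close>)
    moreover have "Le R X Y (Seq R X Y Y \<alpha> \<sigma>) \<alpha>"
      using sat le_trans[OF le_Seq_left[OF X Y \<rho>(1,2) \<alpha>\<sigma>]] rels \<alpha>\<sigma>
      by (simp add: Seq_assoc Seq_Rel)
    ultimately show "Seq R X X Y \<rho> \<alpha> = \<alpha> \<and> Seq R X Y Y \<alpha> \<sigma> = \<alpha>"
      using le_antisym le_Seq_left[OF X Y \<rho>(1,2) \<alpha>] le_Seq_right[OF X Y \<sigma> \<alpha>] rels \<rho>\<alpha> \<alpha>\<sigma>
      by blast }
  show "Le R X Y (Seq R X Y Y (Seq R X X Y (Conv R X X \<rho>) \<alpha>) \<sigma>) \<alpha>"
    if "Seq R X X Y \<rho> \<alpha> = \<alpha> \<and> Seq R X Y Y \<alpha> \<sigma> = \<alpha>"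
    using that by (simp add: \<rho> X Y \<alpha> le_refl)
qed

end


section \<open>The intensional quotient completion is a relational doctrine\<close>

lemma Ob_Tq [simp]: "(X, \<rho>) \<in> Ob (Tq R) \<longleftrightarrow> X \<in> Ob R \<and> equiv_rel R X \<rho>"
  by (simp add: Tq_def)

lemma Hom_Tq [simp]:
  "f \<in> Hom (Tq R) (X, \<rho>) (Y, \<sigma>) \<longleftrightarrow> f \<in> Hom R X Y \<and> Le R X X \<rho> (Reidx R X X Y Y f f \<sigma>)"
  by (simp add: Tq_def)

lemma Tq_simps [simp]:
  "Ident (Tq R) (X, \<rho>) = Ident R X"
  "Comp (Tq R) (X, \<rho>) (Y, \<sigma>) (Z, \<tau>) = Comp R X Y Z"
  "Le (Tq R) (X, \<rho>) (Y, \<sigma>) = Le R X Y"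
  "Reidx (Tq R) (X, \<rho>) (Y, \<sigma>) (A, \<mu>) (B, \<nu>) = Reidx R X Y A B"
  "Diag (Tq R) (X, \<rho>) = \<rho>"
  "Seq (Tq R) (X, \<rho>) (Y, \<sigma>) (Z, \<tau>) = Seq R X Y Z"
  "Conv (Tq R) (X, \<rho>) (Y, \<sigma>) = Conv R X Y"
  by (simp_all add: Tq_def)

lemma Rel_Tq_iff_absorbs:
  assumes "relational_doctrine R" "(X, \<rho>) \<in> Ob (Tq R)" "(Y, \<sigma>) \<in> Ob (Tq R)"
  shows "\<alpha> \<in> Rel (Tq R) (X, \<rho>) (Y, \<sigma>) \<longleftrightarrow>
    \<alpha> \<in> Rel R X Y \<and> Seq R X X Y \<rho> \<alpha> = \<alpha> \<and> Seq R X Y Y \<alpha> \<sigma> = \<alpha>"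
  using relational_doctrine.saturated_iff_absorbs[OF assms(1)] assms(2,3)
  by (auto simp: Tq_def)

lemma Hom_Tq_subset: "Hom (Tq R) (X, \<rho>) (Y, \<sigma>) \<subseteq> Hom R X Y"
  by auto

lemma Rel_Tq_subset: "Rel (Tq R) (X, \<rho>) (Y, \<sigma>) \<subseteq> Rel R X Y"
  by (auto simp: Tq_def)

context relational_doctrine
begin

lemmas Rel_Tq_iff = Rel_Tq_iff_absorbs[OF relational_doctrine_axioms]

text \<open>
  Reindexing is only lax for composition, so absorption has to be transported as an inequality:
  with $\rho \le R_{f,f}(\mu)$ one gets
  $\rho;R_{f,g}(\alpha) \le R_{f,f}(\mu);R_{f,g}(\alpha) \le R_{f,g}(\mu;\alpha) = R_{f,g}(\alpha)$.
\<close>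

lemma Reidx_absorbs_left:
  assumes obs: "X \<in> Ob R" "Y \<in> Ob R" "A \<in> Ob R" "B \<in> Ob R"
    and f: "f \<in> Hom R X A" and g: "g \<in> Hom R Y B"
    and \<rho>: "equiv_rel R X \<rho>" and \<mu>: "\<mu> \<in> Rel R A A" and \<alpha>: "\<alpha> \<in> Rel R A B"
    and le: "Le R X X \<rho> (Reidx R X X A A f f \<mu>)" and absorbs: "Seq R A A B \<mu> \<alpha> = \<alpha>"
  shows "Seq R X X Y \<rho> (Reidx R X Y A B f g \<alpha>) = Reidx R X Y A B f g \<alpha>"
proof -
  have \<rho>: "\<rho> \<in> Rel R X X" "Le R X X (Diag R X) \<rho>"
    using \<rho> by (auto simp: equiv_rel_def)
  let ?\<alpha> = "Reidx R X Y A B f g \<alpha>" and ?\<mu> = "Reidx R X X A A f f \<mu>"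
  have rels: "?\<alpha> \<in> Rel R X Y" "?\<mu> \<in> Rel R X X"
    using obs f g \<mu> \<alpha> by (auto intro: Reidx_Rel)
  have "Le R X Y (Seq R X X Y \<rho> ?\<alpha>) (Seq R X X Y ?\<mu> ?\<alpha>)"
    using obs \<rho> rels le by (auto intro: Seq_mono le_refl)
  moreover have "Le R X Y (Seq R X X Y ?\<mu> ?\<alpha>) ?\<alpha>"
    using Seq_Reidx[of X X Y A A B f f g \<mu> \<alpha>] obs f g \<mu> \<alpha> by (simp add: absorbs)
  ultimately have "Le R X Y (Seq R X X Y \<rho> ?\<alpha>) ?\<alpha>"
    by (rule le_trans) (use obs \<rho> rels in \<open>auto intro: Seq_Rel\<close>)
  then show ?thesis
    using le_Seq_left[OF obs(1,2) \<rho> rels(1)] le_antisym obs \<rho> rels Seq_Rel by blast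
qed

lemma Reidx_absorbs_right:
  assumes obs: "X \<in> Ob R" "Y \<in> Ob R" "A \<in> Ob R" "B \<in> Ob R"
    and f: "f \<in> Hom R X A" and g: "g \<in> Hom R Y B"
    and \<sigma>: "equiv_rel R Y \<sigma>" and \<nu>: "\<nu> \<in> Rel R B B" and \<alpha>: "\<alpha> \<in> Rel R A B"
    and le: "Le R Y Y \<sigma> (Reidx R Y Y B B g g \<nu>)" and absorbs: "Seq R A B B \<alpha> \<nu> = \<alpha>"
  shows "Seq R X Y Y (Reidx R X Y A B f g \<alpha>) \<sigma> = Reidx R X Y A B f g \<alpha>"
proof -
  have \<sigma>: "\<sigma> \<in> Rel R Y Y" "Le R Y Y (Diag R Y) \<sigma>"
    using \<sigma> by (auto simp: equiv_rel_def)
  let ?\<alpha> = "Reidx R X Y A B f g \<alpha>" and ?\<nu> = "Reidx R Y Y B B g g \<nu>"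
  have rels: "?\<alpha> \<in> Rel R X Y" "?\<nu> \<in> Rel R Y Y"
    using obs f g \<nu> \<alpha> by (auto intro: Reidx_Rel)
  have "Le R X Y (Seq R X Y Y ?\<alpha> \<sigma>) (Seq R X Y Y ?\<alpha> ?\<nu>)"
    using obs \<sigma> rels le by (auto intro: Seq_mono le_refl)
  moreover have "Le R X Y (Seq R X Y Y ?\<alpha> ?\<nu>) ?\<alpha>"
    using Seq_Reidx[of X Y Y A B B f g g \<alpha> \<nu>] obs f g \<nu> \<alpha> by (simp add: absorbs)
  ultimately have "Le R X Y (Seq R X Y Y ?\<alpha> \<sigma>) ?\<alpha>"
    by (rule le_trans) (use obs \<sigma> rels in \<open>auto intro: Seq_Rel\<close>)
  then show ?thesis
    using le_Seq_right[OF obs(1,2) \<sigma> rels(1)] le_antisym obs \<sigma> rels Seq_Rel by blast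
qed

lemma equiv_relD:
  assumes "equiv_rel R X \<rho>" "X \<in> Ob R"
  shows "\<rho> \<in> Rel R X X" "Le R X X (Diag R X) \<rho>" "Conv R X X \<rho> = \<rho>" "Seq R X X X \<rho> \<rho> = \<rho>"
  using assms by (auto simp: equiv_rel_iff)

lemma category_Tq: "category (Tq R)"
proof (unfold_locales, goal_cases)
  case (1 X)
  then show ?case
    by (cases X) (simp add: Ident_Hom Reidx_Ident equiv_relD le_refl)
next
  case (2 X Y Z f g)
  obtain X' \<rho> Y' \<sigma> Z' \<tau> where [simp]: "X = (X', \<rho>)" "Y = (Y', \<sigma>)" "Z = (Z', \<tau>)"
    by (metis surj_pair)
  let ?f\<sigma> = "Reidx R X' X' Y' Y' f f \<sigma>" and ?g\<tau> = "Reidx R Y' Y' Z' Z' g g \<tau>"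
  have "Le R X' X' ?f\<sigma> (Reidx R X' X' Y' Y' f f ?g\<tau>)"
    using 2 by (auto simp: Reidx_Rel equiv_relD intro!: reidx_mono)
  then have "Le R X' X' \<rho> (Reidx R X' X' Y' Y' f f ?g\<tau>)"
    using 2 by (elim le_trans[rotated]) (auto simp: Reidx_Rel equiv_relD)
  then show ?case
    using 2 by (simp add: Comp_Hom Reidx_Comp equiv_relD)
qed (auto simp: Comp_Ident_left Comp_Ident_right Comp_assoc)

lemma Tq_doctrine: "relational_doctrine (Tq R)"
proof -
  interpret Q: category "Tq R" by (rule category_Tq)
  show ?thesis
  proof (unfold_locales, goal_cases)
    case (1 X Y)
    then show ?case
      using Rel_Tq_subset by (cases X; cases Y) (fastforce intro!: reflp_onI le_refl)
  next
    case (2 X Y)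
    then show ?case
      using Rel_Tq_subset Le_trans by (cases X; cases Y) (fastforce elim: transp_on_subset)
  next
    case (3 X Y)
    then show ?case
      using Rel_Tq_subset Le_antisym by (cases X; cases Y) (fastforce elim: antisymp_on_subset)
  next
    case (4 X Y A B f g \<alpha>)
    then show ?case
      by (cases X; cases Y; cases A; cases B)
        (auto simp: Rel_Tq_iff equiv_relD Reidx_Rel
          intro!: Reidx_absorbs_left Reidx_absorbs_right)
  next
    case (5 X Y A B f g)
    then show ?case
      by (cases X; cases Y; cases A; cases B)
        (auto simp: Rel_Tq_iff intro!: monotone_onI reidx_mono)
  next
    case (6 X Y \<alpha>)
    then show ?case
      by (cases X; cases Y) (simp add: Rel_Tq_iff Reidx_Ident)
  next
    case (7 X Y A B A' B' f g f' g' \<alpha>)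
    then show ?case
      by (cases X; cases Y; cases A; cases B; cases A'; cases B') (simp add: Rel_Tq_iff Reidx_Comp)
  next
    case (8 X)
    then show ?case
      by (cases X) (simp add: Rel_Tq_iff equiv_relD)
  next
    case (9 X Y f)
    then show ?case
      by (cases X; cases Y) simp
  next
    case (10 X Y Z \<alpha> \<beta>)
    then show ?case
      by (cases X; cases Y; cases Z)
        (simp add: Rel_Tq_iff equiv_relD Seq_Rel, metis Seq_assoc equiv_relD(1))
  next
    case (11 X Y Z \<alpha> \<alpha>' \<beta> \<beta>')
    then show ?case
      by (cases X; cases Y; cases Z) (simp add: Rel_Tq_iff Seq_mono)
  next
    case (12 X Y Z A B D f g h \<alpha> \<beta>)
    then show ?case
      by (cases X; cases Y; cases Z; cases A; cases B; cases D) (simp add: Rel_Tq_iff Seq_Reidx)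
  next
    case (13 W X Y Z \<alpha> \<beta> \<gamma>)
    then show ?case
      by (cases W; cases X; cases Y; cases Z) (simp add: Rel_Tq_iff Seq_assoc)
  next
    case (14 X Y \<alpha>)
    then show ?case
      by (cases X; cases Y) (simp add: Rel_Tq_iff)
  next
    case (15 X Y \<alpha>)
    then show ?case
      by (cases X; cases Y) (simp add: Rel_Tq_iff)
  next
    case (16 X Y \<alpha>)
    \<comment> \<open>Converse exchanges the two absorption equations, equivalence relations being symmetric.\<close>
    then show ?case
      by (cases X; cases Y) (simp add: Rel_Tq_iff Conv_Rel, metis Conv_Seq equiv_relD(1,3))
  next
    case (17 X Y)
    then show ?case
      by (cases X; cases Y) (auto simp: Rel_Tq_iff intro!: monotone_onI conv_mono)
  next
    case (18 X Y A B f g \<alpha>)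
    then show ?case
      by (cases X; cases Y; cases A; cases B) (simp add: Rel_Tq_iff Conv_Reidx)
  next
    case (19 X Y Z \<alpha> \<beta>)
    then show ?case
      by (cases X; cases Y; cases Z) (simp add: Rel_Tq_iff Conv_Seq)
  next
    case (20 X)
    then show ?case
      by (cases X) (simp add: equiv_relD)
  next
    case (21 X Y \<alpha>)
    then show ?case
      by (cases X; cases Y) (simp add: Rel_Tq_iff Conv_Conv)
  qed
qed

end


section \<open>The unit and the action on 1-arrows\<close>

lemma Dom1_Tq1 [simp]: "Dom1 (Tq1 F) = Tq (Dom1 F)"
  and Cod1_Tq1 [simp]: "Cod1 (Tq1 F) = Tq (Cod1 F)"
  and Dom1_Eq [simp]: "Dom1 (Eq R) = R"
  and Cod1_Eq [simp]: "Cod1 (Eq R) = Tq R"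
  by (simp_all add: Tq1_def Eq_def Let_def)

lemma Eq_simps [simp]:
  "X \<in> Ob R \<Longrightarrow> obj_map (Eq R) X = (X, Diag R X)"
  "\<lbrakk>X \<in> Ob R; Y \<in> Ob R; f \<in> Hom R X Y\<rbrakk> \<Longrightarrow> arr_map (Eq R) X Y f = f"
  "\<lbrakk>X \<in> Ob R; Y \<in> Ob R; \<alpha> \<in> Rel R X Y\<rbrakk> \<Longrightarrow> rel_map (Eq R) X Y \<alpha> = \<alpha>"
  by (simp_all add: Eq_def)

lemma Tq1_simps:
  assumes "Dom1 F = R"
  shows "(X, \<rho>) \<in> Ob (Tq R) \<Longrightarrow> obj_map (Tq1 F) (X, \<rho>) = (obj_map F X, rel_map F X X \<rho>)"
    and "\<lbrakk>(X, \<rho>) \<in> Ob (Tq R); (Y, \<sigma>) \<in> Ob (Tq R); f \<in> Hom (Tq R) (X, \<rho>) (Y, \<sigma>)\<rbrakk>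
      \<Longrightarrow> arr_map (Tq1 F) (X, \<rho>) (Y, \<sigma>) f = arr_map F X Y f"
    and "\<lbrakk>(X, \<rho>) \<in> Ob (Tq R); (Y, \<sigma>) \<in> Ob (Tq R); \<alpha> \<in> Rel (Tq R) (X, \<rho>) (Y, \<sigma>)\<rbrakk>
      \<Longrightarrow> rel_map (Tq1 F) (X, \<rho>) (Y, \<sigma>) \<alpha> = rel_map F X Y \<alpha>"
  using assms by (simp_all add: Tq1_def Let_def)

context relational_doctrine
begin

text \<open>Every relation absorbs the diagonals, so the fibres of \<open>R\<close> embed without restriction.\<close>

lemma Rel_Tq_Diag:
  "\<lbrakk>X \<in> Ob R; Y \<in> Ob R\<rbrakk> \<Longrightarrow> Rel (Tq R) (X, Diag R X) (Y, Diag R Y) = Rel R X Y"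
  by (auto simp: Rel_Tq_iff equiv_rel_Diag Seq_Diag_left Seq_Diag_right)

lemma Eq_arrow1: "is_arrow1 (Eq R) R (Tq R)"
proof (rule is_arrow1.intro, goal_cases)
  case 3
  show ?case by (rule relational_doctrine_axioms)
next
  case 4
  show ?case by (rule Tq_doctrine)
next
  case 5
  then show ?case by (auto simp: Eq_def equiv_rel_Diag)
next
  case 6
  then show ?case by (auto simp: Eq_def Diag_Reidx)
next
  case 9
  then show ?case by (auto simp: Eq_def Rel_Tq_Diag)
next
  case (10 X Y)
  then show ?case by (auto intro!: monotone_onI)
qed (simp_all add: Ident_Hom Comp_Hom Reidx_Rel Diag_Rel Seq_Rel Conv_Rel)

end

context is_arrow1
begin

sublocale D: relational_doctrine R by (rule Dom1_doctrine)
sublocale S: relational_doctrine S by (rule Cod1_doctrine)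

lemma obj_map_Ob: "X \<in> Ob R \<Longrightarrow> obj_map F X \<in> Ob S"
  using obj_map_type by auto

lemma arr_map_Hom:
  "\<lbrakk>X \<in> Ob R; Y \<in> Ob R; f \<in> Hom R X Y\<rbrakk> \<Longrightarrow> arr_map F X Y f \<in> Hom S (obj_map F X) (obj_map F Y)"
  using arr_map_type by (blast dest: PiE_mem)

lemma rel_map_Rel:
  "\<lbrakk>X \<in> Ob R; Y \<in> Ob R; \<alpha> \<in> Rel R X Y\<rbrakk> \<Longrightarrow> rel_map F X Y \<alpha> \<in> Rel S (obj_map F X) (obj_map F Y)"
  using rel_map_type by (blast dest: PiE_mem)

lemma rel_map_le:
  "\<lbrakk>Le R X Y \<alpha> \<beta>; X \<in> Ob R; Y \<in> Ob R; \<alpha> \<in> Rel R X Y; \<beta> \<in> Rel R X Y\<rbrakk>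
    \<Longrightarrow> Le S (obj_map F X) (obj_map F Y) (rel_map F X Y \<alpha>) (rel_map F X Y \<beta>)"
  using rel_map_mono by (blast dest: monotone_onD)

lemmas maps_carriers = obj_map_Ob arr_map_Hom rel_map_Rel

lemma rel_map_equiv_rel:
  assumes "X \<in> Ob R" "equiv_rel R X \<rho>"
  shows "equiv_rel S (obj_map F X) (rel_map F X X \<rho>)"
  using D.equiv_relD[OF assms(2,1)] assms(1) rel_map_le[of X X "Diag R X" \<rho>]
  by (simp add: S.equiv_rel_iff maps_carriers D.Diag_Rel flip: rel_map_Conv rel_map_Seq rel_map_Diag)

lemma rel_map_Rel_Tq:
  assumes "(X, \<rho>) \<in> Ob (Tq R)" "(Y, \<sigma>) \<in> Ob (Tq R)" "\<alpha> \<in> Rel (Tq R) (X, \<rho>) (Y, \<sigma>)"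
  shows "rel_map F X Y \<alpha> \<in> Rel (Tq S) (obj_map F X, rel_map F X X \<rho>) (obj_map F Y, rel_map F Y Y \<sigma>)"
  using assms
  by (auto simp: D.Rel_Tq_iff S.Rel_Tq_iff maps_carriers rel_map_equiv_rel D.equiv_relD
      simp flip: rel_map_Seq)

lemma arr_map_Hom_Tq:
  assumes "(X, \<rho>) \<in> Ob (Tq R)" "(Y, \<sigma>) \<in> Ob (Tq R)" "f \<in> Hom (Tq R) (X, \<rho>) (Y, \<sigma>)"
  shows "arr_map F X Y f \<in> Hom (Tq S) (obj_map F X, rel_map F X X \<rho>) (obj_map F Y, rel_map F Y Y \<sigma>)"
  using assms
  by (auto simp: maps_carriers D.equiv_relD D.Reidx_Rel
      intro!: rel_map_le simp flip: rel_map_Reidx)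

lemmas Tq1_maps = Tq1_simps[OF Dom1_eq]

lemma Tq1_arrow1: "is_arrow1 (Tq1 F) (Tq R) (Tq S)"
proof -
  interpret QR: relational_doctrine "Tq R" by (rule D.Tq_doctrine)
  interpret QS: relational_doctrine "Tq S" by (rule S.Tq_doctrine)
  show ?thesis
  proof (unfold_locales, goal_cases)
    case 1
    show ?case by (simp add: Dom1_eq)
  next
    case 2
    show ?case by (simp add: Cod1_eq)
  next
    case 3
    then show ?case
      by (auto simp: Tq1_def Let_def Dom1_eq maps_carriers rel_map_equiv_rel)
  next
    case 4
    have "arr_map (Tq1 F) U V \<in> Hom (Tq R) U V \<rightarrow>\<^sub>E Hom (Tq S) (obj_map (Tq1 F) U) (obj_map (Tq1 F) V)"
      if "U \<in> Ob (Tq R)" "V \<in> Ob (Tq R)" for U V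
      using that arr_map_Hom_Tq
      by (cases U; cases V) (auto simp: Tq1_def Let_def Dom1_eq)
    then show ?case
      by (auto simp: PiE_iff extensional_def Tq1_def Let_def Dom1_eq)
  next
    case (5 X)
    then show ?case
      by (cases X) (use QR.Ident_Hom in \<open>force simp: Tq1_maps arr_map_Ident\<close>)
  next
    case (6 X Y Z f g)
    then show ?case
      using QR.Comp_Hom[OF 6]
      by (cases X; cases Y; cases Z) (simp add: Tq1_maps arr_map_Comp)
  next
    case 7
    have "rel_map (Tq1 F) U V \<in> Rel (Tq R) U V \<rightarrow>\<^sub>E Rel (Tq S) (obj_map (Tq1 F) U) (obj_map (Tq1 F) V)"
      if "U \<in> Ob (Tq R)" "V \<in> Ob (Tq R)" for U V
      using that rel_map_Rel_Tq
      by (cases U; cases V) (auto simp: Tq1_def Let_def Dom1_eq)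
    then show ?case
      by (auto simp: PiE_iff extensional_def Tq1_def Let_def Dom1_eq)
  next
    case (8 X Y)
    then show ?case
      by (cases X; cases Y)
        (auto simp: Tq1_maps intro!: monotone_onI rel_map_le dest: subsetD[OF Rel_Tq_subset])
  next
    case (9 X Y A B f g \<alpha>)
    then show ?case
      using QR.Reidx_Rel[OF 9]
      by (cases X; cases Y; cases A; cases B) (simp add: Tq1_maps D.Rel_Tq_iff rel_map_Reidx)
  next
    case (10 X)
    then show ?case
      using QR.Diag_Rel[OF 10] by (cases X) (simp add: Tq1_maps)
  next
    case (11 X Y Z \<alpha> \<beta>)
    then show ?case
      using QR.Seq_Rel[OF 11]
      by (cases X; cases Y; cases Z) (simp add: Tq1_maps D.Rel_Tq_iff rel_map_Seq)
  next
    case (12 X Y \<alpha>)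
    then show ?case
      using QR.Conv_Rel[OF 12]
      by (cases X; cases Y) (simp add: Tq1_maps D.Rel_Tq_iff rel_map_Conv)
  qed
qed

end


section \<open>Naturality, functoriality and the unit laws\<close>

lemma comp1_boundaries [simp]: "Dom1 (G \<circ>\<^sub>1 F) = Dom1 F" "Cod1 (G \<circ>\<^sub>1 F) = Cod1 G"
  by (simp_all add: comp1_def)

text \<open>Naturality of the unit rests on $\overline F(d_X) = d_{\widehat F X}$.\<close>

lemma Eq_natural:
  assumes "is_arrow1 F R S"
  shows "Eq S \<circ>\<^sub>1 F = Tq1 F \<circ>\<^sub>1 Eq R"
proof -
  interpret F: is_arrow1 F R S by fact
  show ?thesis
    unfolding comp1_def
    by (auto simp: F.Dom1_eq F.Cod1_eq F.Tq1_maps F.maps_carriers F.rel_map_Diag F.D.equiv_rel_Diag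
        F.D.Rel_Tq_Diag F.D.Diag_Reidx intro!: restrict_ext)
qed

lemma Tq1_comp1:
  assumes "is_arrow1 F R S" "is_arrow1 G S T"
  shows "Tq1 (G \<circ>\<^sub>1 F) = Tq1 G \<circ>\<^sub>1 Tq1 F"
proof -
  interpret F: is_arrow1 F R S by fact
  interpret G: is_arrow1 G S T by fact
  note boundaries = F.Dom1_eq F.Cod1_eq G.Dom1_eq G.Cod1_eq
  show ?thesis
    by (intro arrow1.equality)
      (auto simp: comp1_def Tq1_def Let_def boundaries F.maps_carriers F.rel_map_equiv_rel
        F.D.equiv_relD F.arr_map_Hom_Tq F.rel_map_Rel_Tq simp del: Hom_Tq
        dest: subsetD[OF Rel_Tq_subset] subsetD[OF Hom_Tq_subset] intro!: restrict_ext)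
qed

lemma Mq_simps [simp]:
  "Dom1 (Mq R) = Tq (Tq R)"
  "Cod1 (Mq R) = Tq R"
  "U \<in> Ob (Tq (Tq R)) \<Longrightarrow> obj_map (Mq R) U = (fst (fst U), snd U)"
  "\<lbrakk>U \<in> Ob (Tq (Tq R)); V \<in> Ob (Tq (Tq R)); f \<in> Hom (Tq (Tq R)) U V\<rbrakk> \<Longrightarrow> arr_map (Mq R) U V f = f"
  "\<lbrakk>U \<in> Ob (Tq (Tq R)); V \<in> Ob (Tq (Tq R)); \<alpha> \<in> Rel (Tq (Tq R)) U V\<rbrakk> \<Longrightarrow> rel_map (Mq R) U V \<alpha> = \<alpha>"
  by (auto simp: Mq_def Let_def split: prod.splits)

text \<open>
  Since $M$ is the identity on arrows and relations and only changes objects, a 1-arrow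
  into $(R^q)^q$ that is also the identity on arrows and relations is a section of $M$
  as soon as it is so on objects.
\<close>

lemma Mq_comp1_eq_id1:
  assumes "is_arrow1 F (Tq R) (Tq (Tq R))"
    and obj: "\<And>U. U \<in> Ob (Tq R) \<Longrightarrow> obj_map (Mq R) (obj_map F U) = U"
    and arr: "\<And>U V f. \<lbrakk>U \<in> Ob (Tq R); V \<in> Ob (Tq R); f \<in> Hom (Tq R) U V\<rbrakk> \<Longrightarrow> arr_map F U V f = f"
    and rel: "\<And>U V \<alpha>. \<lbrakk>U \<in> Ob (Tq R); V \<in> Ob (Tq R); \<alpha> \<in> Rel (Tq R) U V\<rbrakk> \<Longrightarrow> rel_map F U V \<alpha> = \<alpha>"
  shows "Mq R \<circ>\<^sub>1 F = id1 (Tq R)"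
proof -
  interpret F: is_arrow1 F "Tq R" "Tq (Tq R)" by fact
  have "arr_map (Mq R) (obj_map F U) (obj_map F V) (arr_map F U V f) = f"
    if "U \<in> Ob (Tq R)" "V \<in> Ob (Tq R)" "f \<in> Hom (Tq R) U V" for U V f
    using that F.maps_carriers by (simp add: arr)
  moreover have "rel_map (Mq R) (obj_map F U) (obj_map F V) (rel_map F U V \<alpha>) = \<alpha>"
    if "U \<in> Ob (Tq R)" "V \<in> Ob (Tq R)" "\<alpha> \<in> Rel (Tq R) U V" for U V \<alpha>
    using that F.maps_carriers by (simp add: rel)
  ultimately show ?thesis
    unfolding comp1_def id1_def
    by (auto simp: F.Dom1_eq obj simp del: Mq_simps(3-5) Ob_Tq Hom_Tq intro!: restrict_ext)
qed

lemma Mq_Tq1_Eq: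
  assumes "relational_doctrine R"
  shows "Mq R \<circ>\<^sub>1 Tq1 (Eq R) = id1 (Tq R)"
proof -
  interpret relational_doctrine R by fact
  interpret E: is_arrow1 "Eq R" R "Tq R" by (rule Eq_arrow1)
  interpret TE: is_arrow1 "Tq1 (Eq R)" "Tq R" "Tq (Tq R)" by (rule E.Tq1_arrow1)
  show ?thesis
  proof (rule Mq_comp1_eq_id1[OF TE.is_arrow1_axioms], goal_cases)
    case (1 U)
    then show ?case
      using TE.obj_map_Ob[OF 1] by (cases U) (simp add: E.Tq1_maps equiv_relD)
  next
    case (2 U V f)
    then show ?case
      by (cases U; cases V) (simp add: E.Tq1_maps)
  next
    case (3 U V \<alpha>)
    then show ?case
      by (cases U; cases V) (simp add: E.Tq1_maps Rel_Tq_iff)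
  qed
qed

lemma Mq_Eq_Tq:
  assumes "relational_doctrine R"
  shows "Mq R \<circ>\<^sub>1 Eq (Tq R) = id1 (Tq R)"
proof -
  interpret R: relational_doctrine R by fact
  interpret Q: relational_doctrine "Tq R" by (rule R.Tq_doctrine)
  show ?thesis
  proof (rule Mq_comp1_eq_id1[OF Q.Eq_arrow1], goal_cases)
    case (1 U)
    then show ?case
      using Q.equiv_rel_Diag[OF 1] by (cases U) simp
  qed simp_all
qed


section \<open>The lax idempotency 2-arrow\<close>

definition unit_comparison :: "('o, 'a, 'r) family2" where
  "unit_comparison R = \<lparr>Src2 = Tq1 (Eq R), Trg2 = Eq (Tq R),
     component = (\<lambda>(X, \<rho>)\<in>Ob (Tq R). Ident R X)\<rparr>"

lemma unit_comparison_simps [simp]: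
  "Src2 (unit_comparison R) = Tq1 (Eq R)"
  "Trg2 (unit_comparison R) = Eq (Tq R)"
  "(X, \<rho>) \<in> Ob (Tq R) \<Longrightarrow> component (unit_comparison R) (X, \<rho>) = Ident R X"
  by (simp_all add: unit_comparison_def)

context relational_doctrine
begin

interpretation Q: relational_doctrine "Tq R" by (rule Tq_doctrine)
interpretation E: is_arrow1 "Eq R" R "Tq R" by (rule Eq_arrow1)
interpretation TE: is_arrow1 "Tq1 (Eq R)" "Tq R" "Tq (Tq R)" by (rule E.Tq1_arrow1)
interpretation EQ: is_arrow1 "Eq (Tq R)" "Tq R" "Tq (Tq R)" by (rule Q.Eq_arrow1)

text \<open>
  The arrow condition at the outer level is $\rho \le R_{\mathrm{id},\mathrm{id}}(\rho)$, and at the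
  inner one $d_X \le R_{\mathrm{id},\mathrm{id}}(\rho) = \rho$, which is reflexivity of $\rho$.
\<close>

lemma Ident_Hom_Tq_Tq:
  assumes "(X, \<rho>) \<in> Ob (Tq R)"
  shows "Ident R X \<in> Hom (Tq (Tq R)) ((X, Diag R X), \<rho>) ((X, \<rho>), \<rho>)"
  using assms by (simp add: Ident_Hom Reidx_Ident equiv_relD le_refl)

lemma unit_comparison_arrow2:
  "is_arrow2 (unit_comparison R) (Tq R) (Tq (Tq R)) (Tq1 (Eq R)) (Eq (Tq R))"
proof (rule is_arrow2.intro, goal_cases)
  case 3
  show ?case by (rule TE.is_arrow1_axioms)
next
  case 4
  show ?case by (rule EQ.is_arrow1_axioms)
next
  case 5
  show ?case
    using Ident_Hom_Tq_Tq
    by (auto simp: unit_comparison_def E.Tq1_maps equiv_relD simp del: Hom_Tq)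
next
  case (6 U V f)
  then show ?case
    by (cases U; cases V) (simp add: E.Tq1_maps equiv_relD Comp_Ident_left Comp_Ident_right)
next
  case (7 U V \<alpha>)
  then show ?case
    by (cases U; cases V) (simp add: E.Tq1_maps equiv_relD Rel_Tq_iff Reidx_Ident le_refl)
qed simp_all

lemma unit_comparison_whisker_Eq:
  "unit_comparison R \<triangleleft> Eq R = id2 (Tq1 (Eq R) \<circ>\<^sub>1 Eq R)"
proof -
  have "component (unit_comparison R) (obj_map (Eq R) X)
      = Ident (Tq (Tq R)) (obj_map (Tq1 (Eq R) \<circ>\<^sub>1 Eq R) X)" if "X \<in> Ob R" for X
    using that by (simp add: comp1_def E.Tq1_maps equiv_rel_Diag Diag_Rel)
  moreover have "Eq (Tq R) \<circ>\<^sub>1 Eq R = Tq1 (Eq R) \<circ>\<^sub>1 Eq R"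
    \<comment> \<open>the naturality square of the unit at the 1-arrow \<open>Eq R\<close> itself\<close>
    by (rule Eq_natural[OF Eq_arrow1])
  ultimately show ?thesis
    by (auto simp: whisker_right_def id2_def simp del: Eq_simps intro!: restrict_ext)
qed

lemma Mq_whisker_unit_comparison:
  "Mq R \<triangleright> unit_comparison R = id2 (id1 (Tq R))"
proof -
  have "arr_map (Mq R) (obj_map (Tq1 (Eq R)) U) (obj_map (Eq (Tq R)) U)
      (component (unit_comparison R) U) = Ident (Tq R) U" if U: "U \<in> Ob (Tq R)" for U
    using TE.obj_map_Ob[OF U] EQ.obj_map_Ob[OF U] Ident_Hom_Tq_Tq[of "fst U" "snd U"] U
    by (cases U) (simp add: E.Tq1_maps equiv_relD)
  then show ?thesis
    unfolding whisker_left_def id2_def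
    by (auto simp: Mq_Tq1_Eq[OF relational_doctrine_axioms] Mq_Eq_Tq[OF relational_doctrine_axioms]
        id1_def simp del: Ob_Tq intro!: restrict_ext)
qed

end

lemma lax_idempotent_unit_comparison: "lax_idempotent_family unit_comparison"
  unfolding lax_idempotent_family_def
  by (simp add: relational_doctrine.unit_comparison_arrow2
      relational_doctrine.unit_comparison_whisker_Eq
      relational_doctrine.Mq_whisker_unit_comparison)

text \<open>
  On components naturality is preservation of identities,
  $\widehat F(\mathrm{id}_X)=\mathrm{id}_{\widehat FX}$. The sources agree by applying
  $\mathrm{T}_q$ to the naturality square of $E$ at \<open>F\<close>, the targets by naturality of $E$ at
  $\mathrm{T}_q(F)$.
\<close>

lemma natural_unit_comparison: "natural_family unit_comparison unit_comparison"
  unfolding natural_family_def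
proof (intro allI impI)
  fix R S F
  assume F: "is_arrow1 F R S"
  interpret F: is_arrow1 F R S by fact
  interpret TF: is_arrow1 "Tq1 F" "Tq R" "Tq S" by (rule F.Tq1_arrow1)
  interpret E: is_arrow1 "Eq R" R "Tq R" by (rule F.D.Eq_arrow1)
  interpret TE: is_arrow1 "Tq1 (Eq R)" "Tq R" "Tq (Tq R)" by (rule E.Tq1_arrow1)
  have src: "Tq1 (Eq S) \<circ>\<^sub>1 Tq1 F = Tq1 (Tq1 F) \<circ>\<^sub>1 Tq1 (Eq R)"
    by (simp add: Eq_natural[OF F] flip: Tq1_comp1[OF F F.S.Eq_arrow1]
        Tq1_comp1[OF E.is_arrow1_axioms TF.is_arrow1_axioms])
  have trg: "Eq (Tq S) \<circ>\<^sub>1 Tq1 F = Tq1 (Tq1 F) \<circ>\<^sub>1 Eq (Tq R)"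
    by (rule Eq_natural[OF TF.is_arrow1_axioms])
  have "component (unit_comparison S) (obj_map (Tq1 F) U) =
      arr_map (Tq1 (Tq1 F)) (obj_map (Tq1 (Eq R)) U) (obj_map (Eq (Tq R)) U)
        (component (unit_comparison R) U)" if U: "U \<in> Ob (Tq R)" for U
  proof -
    obtain X \<rho> where [simp]: "U = (X, \<rho>)"
      by fastforce
    have outer: "((X, Diag R X), \<rho>) \<in> Ob (Tq (Tq R))" "((X, \<rho>), \<rho>) \<in> Ob (Tq (Tq R))"
      using TE.obj_map_Ob[OF U] U is_arrow1.obj_map_Ob[OF TF.D.Eq_arrow1 U]
      by (auto simp: E.Tq1_maps F.D.equiv_relD)
    have hom: "Ident R X \<in> Hom (Tq (Tq R)) ((X, Diag R X), \<rho>) ((X, \<rho>), \<rho>)"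
      using U F.D.Ident_Hom_Tq_Tq[of X \<rho>] by simp
    have "arr_map (Tq1 (Tq1 F)) ((X, Diag R X), \<rho>) ((X, \<rho>), \<rho>) (Ident R X)
        = arr_map (Tq1 F) (X, Diag R X) (X, \<rho>) (Ident R X)"
      using TF.Tq1_maps(2)[OF outer hom] .
    also have "\<dots> = arr_map F X X (Ident R X)"
      using outer hom by (intro F.Tq1_maps(2)) auto
    finally show ?thesis
      using U by (simp add: F.Tq1_maps E.Tq1_maps F.arr_map_Ident F.maps_carriers
          F.rel_map_equiv_rel F.D.equiv_relD)
  qed
  then show "unit_comparison S \<triangleleft> Tq1 F = Tq1 (Tq1 F) \<triangleright> unit_comparison R"
    unfolding whisker_right_def whisker_left_def
    by (auto simp: src trg F.Dom1_eq simp del: Ob_Tq intro!: restrict_ext)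
qed

text \<open>
  The same polymorphic construction serves as the family at both choices of carrier types.
\<close>

theorem lemma3p20:
  shows "\<exists>(\<Lambda> :: ('o, 'a, 'r) family2) (\<Lambda>' :: ('p, 'b, 's) family2).
    lax_idempotent_family \<Lambda> \<and> lax_idempotent_family \<Lambda>' \<and>
    natural_family \<Lambda> \<Lambda> \<and> natural_family \<Lambda> \<Lambda>' \<and> natural_family \<Lambda>' \<Lambda> \<and> natural_family \<Lambda>' \<Lambda>'"
  by (intro exI[of _ unit_comparison] conjI lax_idempotent_unit_comparison natural_unit_comparison)

end
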